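(* Every pretight finite game $\Gamma=(N,(C_i)_{i\in N},(U_i)_{i\in N})$ has a quasi-strict Nash equilibrium with support $\prod_{i\in N}C_i^c$, where $C_i^c$ is the set of pure strategies of player $i$ that have positive marginal probability in at least one correlated equilibrium of $\Gamma$.
   Context: A finite game in strategic form is $\Gamma=(N,(C_i)_{i\in N},(U_i)_{i\in N})$, where $N$ is a finite nonempty set of players, $C_i$ is the finite nonempty set of pure strategies of player $i$, $C=\prod_{j\in N}C_j$, $C_{-i}=\prod_{j\ne i}C_j$, and $U_i:C\to\mathbb{R}$ is the utility function of player $i$, extended multilinearly to mixed strategies. A correlated equilibrium of $\Gamma$ is a probability distribution $\mu\in\Delta(C)$ such that $\sum_{c_{-i}\in C_{-i}}\mu(c)[U_i(c_{-i},d_i)-U_i(c)]\le 0$ for all $i\in N$, $c_i,d_i\in C_i$ (where $c=(c_{-i},c_i)$). The marginal probability of $c_i$ in $\mu$ is $\sum_{c_{-i}}\mu(c_{-i},c_i)$. The game is pretight if in every correlated equilibrium $\mu$, $\sum_{c_{-i}\in C_{-i}}\mu(c)[U_i(c_{-i},d_i)-U_i(c)]=0$ for all $i\in N$ and all $c_i,d_i\in C_i^c$. A Nash equilibrium $\sigma$ is quasi-strict if, for every player $i$, every pure best response to $\sigma_{-i}$ belongs to the support of $\sigma_i$. *)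

theory Defs
  imports "HOL-Probability.Probability_Mass_Function"
begin

(* Pure strategies of all players live in one type 'a; player i may use those in
   strategies G i. Profiles are extensional functions on the set of players, and
   (c_{-i}, d_i) is rendered as the function update c(i := d), with c in
   profiles_wo G i and d in strategies G i. The values of utility outside the
   players and profiles are irrelevant. *)

record ('i, 'a) game =
  players :: "'i set"
  strategies :: "'i \<Rightarrow> 'a set"
  utility :: "'i \<Rightarrow> ('i \<Rightarrow> 'a) \<Rightarrow> real"

definition finite_game :: "('i, 'a) game \<Rightarrow> bool" where
  "finite_game G \<longleftrightarrow>
     finite (players G) \<and> players G \<noteq> {} \<and>
     (\<forall>i\<in>players G. finite (strategies G i) \<and> strategies G i \<noteq> {})"

definition profiles :: "('i, 'a) game \<Rightarrow> ('i \<Rightarrow> 'a) set" where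
  "profiles G = (\<Pi>\<^sub>E i\<in>players G. strategies G i)"

definition profiles_wo :: "('i, 'a) game \<Rightarrow> 'i \<Rightarrow> ('i \<Rightarrow> 'a) set" where
  "profiles_wo G i = (\<Pi>\<^sub>E j\<in>players G - {i}. strategies G j)"

definition deviation_gain ::
    "('i, 'a) game \<Rightarrow> ('i \<Rightarrow> 'a) pmf \<Rightarrow> 'i \<Rightarrow> 'a \<Rightarrow> 'a \<Rightarrow> real" where
  "deviation_gain G \<mu> i a d =
     (\<Sum>c\<in>profiles_wo G i.
        pmf \<mu> (c(i := a)) * (utility G i (c(i := d)) - utility G i (c(i := a))))"

definition correlated_equilibrium :: "('i, 'a) game \<Rightarrow> ('i \<Rightarrow> 'a) pmf \<Rightarrow> bool" where
  "correlated_equilibrium G \<mu> \<longleftrightarrow>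
     set_pmf \<mu> \<subseteq> profiles G \<and>
     (\<forall>i\<in>players G. \<forall>a\<in>strategies G i. \<forall>d\<in>strategies G i. deviation_gain G \<mu> i a d \<le> 0)"

definition marginal :: "('i, 'a) game \<Rightarrow> ('i \<Rightarrow> 'a) pmf \<Rightarrow> 'i \<Rightarrow> 'a \<Rightarrow> real" where
  "marginal G \<mu> i a = (\<Sum>c\<in>profiles_wo G i. pmf \<mu> (c(i := a)))"

(* The set written C_i^c: strategies played in some correlated equilibrium. *)
definition coherent :: "('i, 'a) game \<Rightarrow> 'i \<Rightarrow> 'a set" where
  "coherent G i =
     {a \<in> strategies G i. \<exists>\<mu>. correlated_equilibrium G \<mu> \<and> marginal G \<mu> i a > 0}"

definition pretight :: "('i, 'a) game \<Rightarrow> bool" where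
  "pretight G \<longleftrightarrow>
     (\<forall>\<mu>. correlated_equilibrium G \<mu> \<longrightarrow>
       (\<forall>i\<in>players G. \<forall>a\<in>coherent G i. \<forall>d\<in>coherent G i. deviation_gain G \<mu> i a d = 0))"

definition mixed_profile :: "('i, 'a) game \<Rightarrow> ('i \<Rightarrow> 'a pmf) \<Rightarrow> bool" where
  "mixed_profile G \<sigma> \<longleftrightarrow> (\<forall>i\<in>players G. set_pmf (\<sigma> i) \<subseteq> strategies G i)"

definition mixed_utility :: "('i, 'a) game \<Rightarrow> 'i \<Rightarrow> ('i \<Rightarrow> 'a pmf) \<Rightarrow> real" where
  "mixed_utility G i \<sigma> =
     (\<Sum>c\<in>profiles G. (\<Prod>j\<in>players G. pmf (\<sigma> j) (c j)) * utility G i c)"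

(* \<tau> is a mixed best response of player i to \<sigma>_{-i}; the component \<sigma> i is ignored. *)
definition best_response ::
    "('i, 'a) game \<Rightarrow> 'i \<Rightarrow> ('i \<Rightarrow> 'a pmf) \<Rightarrow> 'a pmf \<Rightarrow> bool" where
  "best_response G i \<sigma> \<tau> \<longleftrightarrow>
     set_pmf \<tau> \<subseteq> strategies G i \<and>
     (\<forall>\<rho>. set_pmf \<rho> \<subseteq> strategies G i \<longrightarrow>
       mixed_utility G i (\<sigma>(i := \<rho>)) \<le> mixed_utility G i (\<sigma>(i := \<tau>)))"

definition nash_equilibrium :: "('i, 'a) game \<Rightarrow> ('i \<Rightarrow> 'a pmf) \<Rightarrow> bool" where
  "nash_equilibrium G \<sigma> \<longleftrightarrow>
     mixed_profile G \<sigma> \<and> (\<forall>i\<in>players G. best_response G i \<sigma> (\<sigma> i))"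

definition quasi_strict :: "('i, 'a) game \<Rightarrow> ('i \<Rightarrow> 'a pmf) \<Rightarrow> bool" where
  "quasi_strict G \<sigma> \<longleftrightarrow>
     (\<forall>i\<in>players G. \<forall>a\<in>strategies G i.
       best_response G i \<sigma> (return_pmf a) \<longrightarrow> a \<in> set_pmf (\<sigma> i))"

definition profile_support :: "('i, 'a) game \<Rightarrow> ('i \<Rightarrow> 'a pmf) \<Rightarrow> ('i \<Rightarrow> 'a) set" where
  "profile_support G \<sigma> = (\<Pi>\<^sub>E i\<in>players G. set_pmf (\<sigma> i))"

end

theory Submission
  imports Defs
begin

text \<open>
  Write \<open>S i\<close> for the set \<open>coherent G i\<close>. Correlated equilibria are the solutions of a linear
  program, and all that is used about them is one dual solution \<open>y\<close>: nonnegative numbers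
  \<open>y (i, a, d)\<close>, read as the rate at which player \<open>i\<close> is tempted to replace \<open>a\<close> by \<open>d\<close>.
  Whenever a strategy has probability 0, or an incentive constraint holds with equality, in all
  correlated equilibria, Farkas' lemma makes the corresponding part of the dual strict. So in a
  pretight game \<open>y\<close> can be chosen (lemma \<open>pretight_dual_vector\<close>) such that
  \<open>y (i, a, d) > 0\<close> for all \<open>a\<close>, \<open>d\<close> in \<open>S i\<close>, and such that at each pure profile the sum over
  the players of the gains from moving along \<open>y\<close> is nonnegative, and at least 1 when some player
  uses a strategy outside \<open>S i\<close>.

  The equilibrium is \<open>\<sigma>\<close>, where \<open>\<sigma> i\<close> is a stationary distribution of the jump process with
  rates \<open>y (i, _, _)\<close>. A player who randomizes with a stationary distribution gains nothing on
  average by moving along \<open>y\<close>, whatever the others do independently (lemmas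
  \<open>stationary_drift\<close> and \<open>expected_drift\<close>). This has two consequences.

  If all players use \<open>\<sigma>\<close>, the expected total gain is 0, so \<open>\<sigma>\<close> puts no weight on profiles
  with total gain at least 1: the support of \<open>\<sigma> i\<close> lies in \<open>S i\<close>. Supports of stationary
  distributions are closed under moves of positive rate, so this support is all of \<open>S i\<close>.

  If only player \<open>i\<close> deviates to a pure strategy \<open>a\<close>, the gains of the others still average to 0,
  so the gain of \<open>i\<close> from moving away from \<open>a\<close> along \<open>y\<close> is nonnegative, and at least 1 if
  \<open>a\<close> is outside \<open>S i\<close>. At a best reply to \<open>\<sigma>\<close> no move has positive gain. Hence every pure
  best reply lies in \<open>S i\<close>, which is quasi-strictness. Moreover all moves of positive rate from a
  best reply lead to best replies, so every element of \<open>S i\<close> is a best reply and \<open>\<sigma>\<close> is a Nash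
  equilibrium.
\<close>

section \<open>Farkas' lemma over finite index sets\<close>

text \<open>
  The vectors are functions on a finite subset of an arbitrary type, so that the lemma applies to
  sets of strategy profiles. The proof is the algebraic one by induction on the number of
  inequalities: either the new inequality is redundant, or a vector \<open>w\<close> witnessing the contrary
  serves to eliminate it.
\<close>
lemma farkas:
  fixes A :: "'k \<Rightarrow> 'x \<Rightarrow> real" and b :: "'x \<Rightarrow> real"
  assumes "finite K" and X: "finite X"
    and "\<And>v. (\<And>k. k \<in> K \<Longrightarrow> (\<Sum>x\<in>X. A k x * v x) \<le> 0) \<Longrightarrow> (\<Sum>x\<in>X. b x * v x) \<le> 0"
  shows "\<exists>y. (\<forall>k\<in>K. 0 \<le> y k) \<and> (\<forall>x\<in>X. b x = (\<Sum>k\<in>K. y k * A k x))"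
  using assms(1,3)
proof (induction K arbitrary: A b rule: finite_induct)
  case empty
  have "(\<Sum>x\<in>X. b x * b x) \<le> 0" using empty by simp
  moreover have "(\<Sum>x\<in>X. b x * b x) \<ge> 0" by (intro sum_nonneg) simp
  ultimately have "\<forall>x\<in>X. b x * b x = 0"
    using X sum_nonneg_eq_0_iff[of X "\<lambda>x. b x * b x"] by force
  then show ?case by simp
next
  case (insert m K)
  let ?p = "\<lambda>f v. \<Sum>x\<in>X. f x * (v x :: real)"
  show ?case
  proof (cases "\<forall>v. (\<forall>k\<in>K. ?p (A k) v \<le> 0) \<longrightarrow> ?p b v \<le> 0")
    case True
    then obtain y where y: "\<forall>k\<in>K. 0 \<le> y k" "\<forall>x\<in>X. b x = (\<Sum>k\<in>K. y k * A k x)"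
      using insert.IH[of A b] by blast
    have *: "(\<Sum>k\<in>K. (y(m := 0)) k * A k x) = (\<Sum>k\<in>K. y k * A k x)" for x
      using insert.hyps by (intro sum.cong) auto
    show ?thesis
      by (rule exI[of _ "y(m := 0)"]) (use y insert.hyps * in auto)
  next
    case False
    then obtain w where w: "\<forall>k\<in>K. ?p (A k) w \<le> 0" "?p b w > 0" by (auto simp: not_le)
    have mw: "?p (A m) w > 0"
      using insert.prems[of w] w by (metis insert_iff not_le)
    \<comment> \<open>\<open>shift\<close> projects along \<open>w\<close> onto the kernel of the functional \<open>A m\<close>, and \<open>proj\<close> is its
        adjoint. The projected system satisfies the hypothesis without \<open>m\<close>.\<close>
    define r where "r f = ?p f w / ?p (A m) w" for f
    define proj where "proj f x = f x - r f * A m x" for f x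
    define q where "q v = ?p (A m) v / ?p (A m) w" for v
    define shift where "shift v x = v x - q v * w x" for v x
    have p_shift: "?p f (shift v) = ?p f v - q v * ?p f w" for f v
      by (simp add: shift_def right_diff_distrib sum_subtractf sum_distrib_left mult_ac)
    have p_proj: "?p (proj f) v = ?p f v - r f * ?p (A m) v" for f v
      unfolding proj_def left_diff_distrib sum_subtractf
      by (simp add: sum_distrib_left mult.assoc)
    have adj: "?p (proj f) v = ?p f (shift v)" for f v
      unfolding p_shift p_proj by (simp add: r_def q_def)
    have "?p (A m) (shift v) = 0" for v unfolding p_shift using mw by (simp add: q_def)
    then have "?p (proj b) v \<le> 0" if "\<And>k. k \<in> K \<Longrightarrow> ?p (proj (A k)) v \<le> 0" for v
      unfolding adj using that unfolding adj by (intro insert.prems) auto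
    then obtain y where y: "\<forall>k\<in>K. 0 \<le> y k"
        "\<forall>x\<in>X. proj b x = (\<Sum>k\<in>K. y k * proj (A k) x)"
      using insert.IH[of "\<lambda>k. proj (A k)" "proj b"] by blast
    \<comment> \<open>Undoing the projection leaves a multiple of \<open>A m\<close>; its coefficient is nonnegative because
        \<open>w\<close> satisfies the inequalities of \<open>K\<close> and violates that of \<open>b\<close>.\<close>
    define t where "t = r b - (\<Sum>k\<in>K. y k * r (A k))"
    have "(\<Sum>k\<in>K. y k * r (A k)) \<le> 0"
      using y(1) w(1) mw by (intro sum_nonpos mult_nonneg_nonpos) (auto simp: r_def divide_nonpos_pos)
    moreover have "r b > 0" using w mw by (simp add: r_def)
    ultimately have t: "t \<ge> 0" by (simp add: t_def)
    have "b x = t * A m x + (\<Sum>k\<in>K. y k * A k x)" if "x \<in> X" for x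
    proof -
      have "b x - r b * A m x = (\<Sum>k\<in>K. y k * A k x) - (\<Sum>k\<in>K. y k * r (A k)) * A m x"
      proof -
        have "b x - r b * A m x = (\<Sum>k\<in>K. y k * proj (A k) x)"
          using y(2) that by (simp add: proj_def)
        then show ?thesis
          by (simp only: proj_def right_diff_distrib sum_subtractf sum_distrib_right mult.assoc)
      qed
      then show ?thesis by (simp add: t_def algebra_simps)
    qed
    moreover have "(\<Sum>k\<in>K. (y(m := t)) k * A k x) = (\<Sum>k\<in>K. y k * A k x)" for x
      using insert.hyps by (intro sum.cong) auto
    ultimately show ?thesis
      by (intro exI[of _ "y(m := t)"]) (use y t insert.hyps in auto)
  qed
qed

text \<open>
  Sign constraints on the variables are further inequalities; their multipliers are the slack
  between the two sides of the conclusion.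
\<close>
lemma farkas_nonneg:
  fixes A :: "'k \<Rightarrow> 'x \<Rightarrow> real" and b :: "'x \<Rightarrow> real"
  assumes K: "finite K" and X: "finite X"
    and imp: "\<And>v. \<lbrakk>\<And>x. x \<in> X \<Longrightarrow> 0 \<le> v x; \<And>k. k \<in> K \<Longrightarrow> (\<Sum>x\<in>X. A k x * v x) \<le> 0\<rbrakk>
                 \<Longrightarrow> (\<Sum>x\<in>X. b x * v x) \<le> 0"
  shows "\<exists>y. (\<forall>k\<in>K. 0 \<le> y k) \<and> (\<forall>x\<in>X. b x \<le> (\<Sum>k\<in>K. y k * A k x))"
proof -
  define B where "B k x = (case k of Inl k \<Rightarrow> A k x | Inr z \<Rightarrow> if x = z then -1 else 0)"
    for k :: "'k + 'x" and x
  have B_Inr: "(\<Sum>x\<in>X. B (Inr z) x * v x) = - v z" if "z \<in> X" for z v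
  proof -
    have "(\<Sum>x\<in>X. B (Inr z) x * v x) = (\<Sum>x\<in>X. if x = z then - v x else 0)"
      by (intro sum.cong) (auto simp: B_def)
    then show ?thesis using that X by simp
  qed
  have "\<exists>y. (\<forall>k\<in>K <+> X. 0 \<le> y k) \<and> (\<forall>x\<in>X. b x = (\<Sum>k\<in>K <+> X. y k * B k x))"
  proof (rule farkas)
    fix v assume v: "\<And>k. k \<in> K <+> X \<Longrightarrow> (\<Sum>x\<in>X. B k x * v x) \<le> 0"
    show "(\<Sum>x\<in>X. b x * v x) \<le> 0"
    proof (rule imp)
      show "0 \<le> v x" if "x \<in> X" for x using v[of "Inr x"] B_Inr[OF that] that by auto
      show "(\<Sum>x\<in>X. A k x * v x) \<le> 0" if "k \<in> K" for k
        using v[of "Inl k"] that by (auto simp: B_def)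
    qed
  qed (use K X in auto)
  then obtain y where y: "\<forall>k\<in>K <+> X. 0 \<le> y k" "\<forall>x\<in>X. b x = (\<Sum>k\<in>K <+> X. y k * B k x)"
    by blast
  have "b x \<le> (\<Sum>k\<in>K. y (Inl k) * A k x)" if "x \<in> X" for x
  proof -
    have "b x = (\<Sum>k\<in>K. y (Inl k) * A k x) + (\<Sum>z\<in>X. y (Inr z) * B (Inr z) x)"
      using y(2) that K X by (simp add: sum.Plus B_def)
    moreover have "(\<Sum>z\<in>X. y (Inr z) * B (Inr z) x) \<le> 0"
      using y(1) by (intro sum_nonpos mult_nonneg_nonpos) (auto simp: B_def)
    ultimately show ?thesis by simp
  qed
  then show ?thesis using y(1) by (intro exI[of _ "\<lambda>k. y (Inl k)"]) auto
qed

section \<open>Distributions on finite sets and stationary distributions\<close>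

lemma finite_has_maximizer:
  fixes u :: "'a \<Rightarrow> real"
  assumes "finite S" "S \<noteq> {}"
  shows "\<exists>a\<in>S. \<forall>d\<in>S. u d \<le> u a"
proof -
  have "Max (u ` S) \<in> u ` S" using assms by (intro Max_in) auto
  then obtain a where "a \<in> S" "Max (u ` S) = u a" by blast
  then show ?thesis using assms by (metis Max_ge finite_imageI imageI)
qed

lemma pmf_of_weights:
  fixes v :: "'x \<Rightarrow> real"
  assumes X: "finite X" and v: "\<And>x. x \<in> X \<Longrightarrow> 0 \<le> v x" and pos: "0 < (\<Sum>x\<in>X. v x)"
  shows "\<exists>p. set_pmf p \<subseteq> X \<and> (\<forall>x\<in>X. v x = (\<Sum>z\<in>X. v z) * pmf p x)"
proof -
  define s where "s = (\<Sum>x\<in>X. v x)"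
  define f where "f x = (if x \<in> X then v x / s else 0)" for x
  have f0: "0 \<le> f x" for x using v pos by (auto simp: f_def s_def)
  have "(\<integral>\<^sup>+ x. ennreal (f x) \<partial>count_space UNIV) = (\<Sum>x\<in>X. ennreal (f x))"
    by (rule nn_integral_count_space') (use X in \<open>auto simp: f_def\<close>)
  also have "\<dots> = ennreal (\<Sum>x\<in>X. f x)" using f0 by simp
  also have "(\<Sum>x\<in>X. f x) = 1"
    using pos by (simp add: f_def s_def flip: sum_divide_distrib)
  finally have 1: "(\<integral>\<^sup>+ x. ennreal (f x) \<partial>count_space UNIV) = 1" by simp
  have pf: "pmf (embed_pmf f) x = f x" for x using pmf_embed_pmf[OF f0 1] .
  have "set_pmf (embed_pmf f) \<subseteq> X"
    unfolding set_pmf_iff pf subset_iff by (simp add: f_def set_pmf_iff pf)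
  moreover have "\<forall>x\<in>X. v x = s * pmf (embed_pmf f) x"
    using pos unfolding pf by (auto simp: f_def s_def)
  ultimately show ?thesis unfolding s_def by blast
qed

text \<open>
  The numbers \<open>r a d\<close> are jump rates of a continuous-time chain on \<open>S\<close>: rows need not sum to 1.
  The equation balances the flow into and out of \<open>d\<close>.
\<close>
definition stationary :: "'a set \<Rightarrow> ('a \<Rightarrow> 'a \<Rightarrow> real) \<Rightarrow> 'a pmf \<Rightarrow> bool" where
  "stationary S r p \<longleftrightarrow>
     (\<forall>d\<in>S. (\<Sum>a\<in>S. pmf p a * r a d) = pmf p d * (\<Sum>e\<in>S. r d e))"

text \<open>
  By Farkas' lemma, the alternative to a stationary distribution is a potential \<open>u\<close> whose expected
  increase is at least 1 at every state, which is impossible where \<open>u\<close> is maximal.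
\<close>
lemma stationary_exists:
  fixes r :: "'a \<Rightarrow> 'a \<Rightarrow> real"
  assumes S: "finite S" "S \<noteq> {}" and r: "\<And>a d. \<lbrakk>a \<in> S; d \<in> S\<rbrakk> \<Longrightarrow> 0 \<le> r a d"
  shows "\<exists>p. set_pmf p \<subseteq> S \<and> stationary S r p"
proof -
  define A where "A d a = r a d - (if a = d then (\<Sum>e\<in>S. r a e) else 0)" for d a
  have A_v: "(\<Sum>a\<in>S. A d a * v a) = (\<Sum>a\<in>S. v a * r a d) - v d * (\<Sum>e\<in>S. r d e)"
    if "d \<in> S" for d v
  proof -
    have "(\<Sum>a\<in>S. A d a * v a) =
        (\<Sum>a\<in>S. v a * r a d - (if a = d then v a * (\<Sum>e\<in>S. r a e) else 0))"
      by (intro sum.cong) (auto simp: A_def algebra_simps)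
    then show ?thesis using S that by (simp add: sum_subtractf)
  qed
  have "\<exists>v. (\<forall>x\<in>S. 0 \<le> v x) \<and> (\<forall>d\<in>S. (\<Sum>a\<in>S. A d a * v a) \<le> 0) \<and> (\<Sum>x\<in>S. v x) > 0"
  proof (rule ccontr)
    assume neg: "\<not> ?thesis"
    have "\<exists>u. (\<forall>d\<in>S. 0 \<le> u d) \<and> (\<forall>a\<in>S. 1 \<le> (\<Sum>d\<in>S. u d * A d a))"
    proof (rule farkas_nonneg[OF S(1) S(1)])
      fix v assume "\<And>x. x \<in> S \<Longrightarrow> 0 \<le> v x" "\<And>d. d \<in> S \<Longrightarrow> (\<Sum>a\<in>S. A d a * v a) \<le> 0"
      then have "\<not> 0 < (\<Sum>x\<in>S. v x)" using neg by blast
      then show "(\<Sum>x\<in>S. 1 * v x) \<le> 0" by simp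
    qed
    then obtain u where u: "\<forall>a\<in>S. 1 \<le> (\<Sum>d\<in>S. u d * A d a)" by blast
    obtain a where a: "a \<in> S" "\<forall>d\<in>S. u d \<le> u a"
      using finite_has_maximizer[OF S] by blast
    have "(\<Sum>d\<in>S. u d * A d a) = (\<Sum>d\<in>S. u d * r a d - (if a = d then u d * (\<Sum>e\<in>S. r a e) else 0))"
      by (intro sum.cong) (auto simp: A_def algebra_simps)
    also have "\<dots> = (\<Sum>d\<in>S. r a d * (u d - u a))"
      using S a by (simp add: sum_subtractf sum_distrib_left algebra_simps)
    also have "\<dots> \<le> 0" using a r by (intro sum_nonpos mult_nonneg_nonpos) auto
    finally show False using u a by force
  qed
  then obtain v where v: "\<forall>x\<in>S. 0 \<le> v x" "\<forall>d\<in>S. (\<Sum>a\<in>S. A d a * v a) \<le> 0" "(\<Sum>x\<in>S. v x) > 0"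
    by blast
  \<comment> \<open>Total inflow equals total outflow, so inequality in all states forces equality.\<close>
  have "(\<Sum>d\<in>S. \<Sum>a\<in>S. A d a * v a) = (\<Sum>d\<in>S. \<Sum>a\<in>S. v a * r a d) - (\<Sum>d\<in>S. v d * (\<Sum>e\<in>S. r d e))"
    by (simp add: A_v sum_subtractf)
  also have "\<dots> = 0" by (subst sum.swap) (simp add: sum_distrib_left)
  finally have "\<forall>d\<in>S. (\<Sum>a\<in>S. A d a * v a) = 0"
    using v(2) S sum_nonneg_eq_0_iff[of S "\<lambda>d. - (\<Sum>a\<in>S. A d a * v a)"]
    by (simp add: sum_negf)
  then have bal: "\<forall>d\<in>S. (\<Sum>a\<in>S. v a * r a d) = v d * (\<Sum>e\<in>S. r d e)"
    by (simp add: A_v)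
  define s where "s = (\<Sum>x\<in>S. v x)"
  obtain p where p: "set_pmf p \<subseteq> S" "\<forall>x\<in>S. v x = s * pmf p x"
    using pmf_of_weights[of S v] v S unfolding s_def by blast
  have "s * (\<Sum>a\<in>S. pmf p a * r a d) = s * (pmf p d * (\<Sum>e\<in>S. r d e))" if "d \<in> S" for d
  proof -
    have "s * (\<Sum>a\<in>S. pmf p a * r a d) = (\<Sum>a\<in>S. v a * r a d)"
      unfolding sum_distrib_left by (intro sum.cong) (use p(2) in auto)
    then show ?thesis using bal that p(2) by simp
  qed
  moreover have "s \<noteq> 0" using v(3) by (simp add: s_def)
  ultimately have "stationary S r p" by (simp add: stationary_def)
  then show ?thesis using p by blast
qed

lemma stationary_drift:
  fixes r :: "'a \<Rightarrow> 'a \<Rightarrow> real" and u :: "'a \<Rightarrow> real"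
  assumes "stationary S r p"
  shows "(\<Sum>a\<in>S. pmf p a * (\<Sum>d\<in>S. r a d * (u d - u a))) = 0"
proof -
  have "(\<Sum>a\<in>S. pmf p a * (\<Sum>d\<in>S. r a d * (u d - u a)))
      = (\<Sum>a\<in>S. \<Sum>d\<in>S. pmf p a * r a d * u d) - (\<Sum>a\<in>S. \<Sum>d\<in>S. pmf p a * r a d * u a)"
    by (simp add: sum_distrib_left sum_subtractf algebra_simps)
  also have "(\<Sum>a\<in>S. \<Sum>d\<in>S. pmf p a * r a d * u d) = (\<Sum>d\<in>S. (\<Sum>a\<in>S. pmf p a * r a d) * u d)"
    by (subst sum.swap) (simp add: sum_distrib_right)
  also have "\<dots> = (\<Sum>d\<in>S. (pmf p d * (\<Sum>e\<in>S. r d e)) * u d)"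
    using assms by (simp add: stationary_def)
  also have "\<dots> = (\<Sum>a\<in>S. \<Sum>d\<in>S. pmf p a * r a d * u a)"
    by (simp add: sum_distrib_left sum_distrib_right mult_ac)
  finally show ?thesis by simp
qed

lemma stationary_support_closed:
  fixes r :: "'a \<Rightarrow> 'a \<Rightarrow> real"
  assumes S: "finite S" and r: "\<And>a d. \<lbrakk>a \<in> S; d \<in> S\<rbrakk> \<Longrightarrow> 0 \<le> r a d"
    and p: "stationary S r p" and a: "a \<in> S" "a \<in> set_pmf p" and d: "d \<in> S" "0 < r a d"
  shows "d \<in> set_pmf p"
proof -
  have "0 < pmf p a * r a d" using a d by (simp add: pmf_positive)
  also have "\<dots> \<le> (\<Sum>a\<in>S. pmf p a * r a d)"
    using S a d r by (intro member_le_sum) auto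
  also have "\<dots> = pmf p d * (\<Sum>e\<in>S. r d e)" using p d by (simp add: stationary_def)
  finally show ?thesis by (auto simp: set_pmf_iff)
qed

section \<open>Sums over strategy profiles\<close>

lemma finite_profiles: "finite_game G \<Longrightarrow> finite (profiles G)"
  unfolding profiles_def finite_game_def by (intro finite_PiE) auto

lemma finite_profiles_wo: "finite_game G \<Longrightarrow> finite (profiles_wo G i)"
  unfolding profiles_wo_def finite_game_def by (intro finite_PiE) auto

lemma sum_profiles:
  fixes f :: "('i \<Rightarrow> 'a) \<Rightarrow> real"
  assumes "i \<in> players G"
  shows "(\<Sum>c\<in>profiles G. f c) = (\<Sum>a\<in>strategies G i. \<Sum>c\<in>profiles_wo G i. f (c(i := a)))"
proof -
  have "profiles G = (\<lambda>(a, c). c(i := a)) ` (strategies G i \<times> profiles_wo G i)"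
    using assms unfolding profiles_def profiles_wo_def
    by (metis PiE_insert_eq insert_Diff)
  moreover have "inj_on (\<lambda>(a, c). c(i := a)) (strategies G i \<times> profiles_wo G i)"
    unfolding profiles_wo_def by (rule inj_combinator) simp
  ultimately show ?thesis
    by (simp add: sum.reindex sum.cartesian_product case_prod_unfold)
qed

definition product_weight :: "('i, 'a) game \<Rightarrow> ('i \<Rightarrow> 'a pmf) \<Rightarrow> ('i \<Rightarrow> 'a) \<Rightarrow> real" where
  "product_weight G \<tau> c = (\<Prod>j\<in>players G. pmf (\<tau> j) (c j))"

lemma product_weight_nonneg: "0 \<le> product_weight G \<tau> c"
  by (simp add: product_weight_def prod_nonneg)

lemma sum_product_weight:
  assumes "finite_game G" "mixed_profile G \<tau>"
  shows "(\<Sum>c\<in>profiles G. product_weight G \<tau> c) = 1"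
proof -
  have "(\<Sum>c\<in>profiles G. product_weight G \<tau> c)
      = (\<Prod>j\<in>players G. \<Sum>a\<in>strategies G j. pmf (\<tau> j) a)"
    unfolding profiles_def product_weight_def
    using assms(1) by (intro prod_sum_PiE[symmetric]) (auto simp: finite_game_def)
  also have "\<dots> = 1"
    using assms by (intro prod.neutral ballI sum_pmf_eq_1) (auto simp: finite_game_def mixed_profile_def)
  finally show ?thesis .
qed

lemma product_weight_update:
  assumes "finite_game G" "i \<in> players G"
  shows "product_weight G (\<tau>(i := \<rho>)) (c(i := a))
       = pmf \<rho> a * (\<Prod>j\<in>players G - {i}. pmf (\<tau> j) (c j))"
proof -
  have "finite (players G)" using assms by (simp add: finite_game_def)
  then have "product_weight G (\<tau>(i := \<rho>)) (c(i := a))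
      = pmf \<rho> a * (\<Prod>j\<in>players G - {i}. pmf ((\<tau>(i := \<rho>)) j) ((c(i := a)) j))"
    unfolding product_weight_def by (subst prod.remove[OF _ assms(2)]) auto
  also have "(\<Prod>j\<in>players G - {i}. pmf ((\<tau>(i := \<rho>)) j) ((c(i := a)) j))
      = (\<Prod>j\<in>players G - {i}. pmf (\<tau> j) (c j))"
    by (intro prod.cong) auto
  finally show ?thesis .
qed

definition pure_payoff :: "('i, 'a) game \<Rightarrow> ('i \<Rightarrow> 'a pmf) \<Rightarrow> 'i \<Rightarrow> 'a \<Rightarrow> real" where
  "pure_payoff G \<tau> i a = mixed_utility G i (\<tau>(i := return_pmf a))"

lemma pure_payoff_eq:
  assumes "finite_game G" "i \<in> players G" "a \<in> strategies G i"
  shows "pure_payoff G \<tau> i a =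
    (\<Sum>c\<in>profiles_wo G i. (\<Prod>j\<in>players G - {i}. pmf (\<tau> j) (c j)) * utility G i (c(i := a)))"
proof -
  have fin: "finite (strategies G i)" using assms by (simp add: finite_game_def)
  have "pure_payoff G \<tau> i a = (\<Sum>b\<in>strategies G i. if b = a then
     (\<Sum>c\<in>profiles_wo G i. (\<Prod>j\<in>players G - {i}. pmf (\<tau> j) (c j)) * utility G i (c(i := b))) else 0)"
    unfolding pure_payoff_def mixed_utility_def product_weight_def[symmetric] sum_profiles[OF assms(2)]
      product_weight_update[OF assms(1,2)]
    by (intro sum.cong) (auto simp: indicator_def)
  then show ?thesis using assms fin by simp
qed

lemma mixed_utility_linear:
  assumes "finite_game G" "i \<in> players G"
  shows "mixed_utility G i (\<tau>(i := \<rho>)) = (\<Sum>a\<in>strategies G i. pmf \<rho> a * pure_payoff G \<tau> i a)"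
  unfolding mixed_utility_def product_weight_def[symmetric] sum_profiles[OF assms(2)]
      product_weight_update[OF assms]
  by (intro sum.cong) (auto simp: pure_payoff_eq[OF assms] sum_distrib_left mult_ac)

section \<open>Dual vectors and their drift\<close>

text \<open>
  The coefficient of the probability of \<open>c\<close> in the incentive constraint indexed by \<open>(i, a, d)\<close>.
\<close>
definition gain_row :: "('i, 'a) game \<Rightarrow> 'i \<times> 'a \<times> 'a \<Rightarrow> ('i \<Rightarrow> 'a) \<Rightarrow> real" where
  "gain_row G = (\<lambda>(i, a, d) c. if c i = a then utility G i (c(i := d)) - utility G i c else 0)"

definition deviations :: "('i, 'a) game \<Rightarrow> ('i \<times> 'a \<times> 'a) set" where
  "deviations G = (SIGMA i:players G. strategies G i \<times> strategies G i)"

lemma finite_deviations: "finite_game G \<Longrightarrow> finite (deviations G)"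
  unfolding deviations_def finite_game_def by auto

lemma sum_gain_row:
  fixes m :: "('i \<Rightarrow> 'a) \<Rightarrow> real"
  assumes "finite_game G" "i \<in> players G" "a \<in> strategies G i"
  shows "(\<Sum>c\<in>profiles G. gain_row G (i, a, d) c * m c)
       = (\<Sum>c\<in>profiles_wo G i. m (c(i := a)) * (utility G i (c(i := d)) - utility G i (c(i := a))))"
proof -
  have fin: "finite (strategies G i)" using assms by (simp add: finite_game_def)
  have "(\<Sum>c\<in>profiles G. gain_row G (i, a, d) c * m c)
     = (\<Sum>b\<in>strategies G i. if b = a then
        (\<Sum>c\<in>profiles_wo G i. m (c(i := b)) * (utility G i (c(i := d)) - utility G i (c(i := b)))) else 0)"
    unfolding sum_profiles[OF assms(2)] by (intro sum.cong) (auto simp: gain_row_def mult.commute)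
  then show ?thesis using fin assms by simp
qed

lemma deviation_gain_eq:
  assumes "finite_game G" "i \<in> players G" "a \<in> strategies G i"
  shows "deviation_gain G \<mu> i a d = (\<Sum>c\<in>profiles G. gain_row G (i, a, d) c * pmf \<mu> c)"
  by (simp add: sum_gain_row[OF assms] deviation_gain_def)

lemma expected_gain_row:
  assumes "finite_game G" "i \<in> players G" "a \<in> strategies G i" "d \<in> strategies G i"
  shows "(\<Sum>c\<in>profiles G. gain_row G (i, a, d) c * product_weight G \<tau> c)
       = pmf (\<tau> i) a * (pure_payoff G \<tau> i d - pure_payoff G \<tau> i a)"
proof -
  have *: "product_weight G \<tau> (c(i := a)) = pmf (\<tau> i) a * (\<Prod>j\<in>players G - {i}. pmf (\<tau> j) (c j))"
    for c using product_weight_update[OF assms(1,2), of \<tau> "\<tau> i"] by simp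
  show ?thesis
    unfolding sum_gain_row[OF assms(1-3)] * pure_payoff_eq[OF assms(1,2,3)] pure_payoff_eq[OF assms(1,2,4)]
    by (simp add: sum_distrib_left sum_subtractf right_diff_distrib mult_ac)
qed

definition drift :: "('i, 'a) game \<Rightarrow> ('i \<times> 'a \<times> 'a \<Rightarrow> real) \<Rightarrow> ('i \<Rightarrow> 'a pmf) \<Rightarrow> 'i \<Rightarrow> 'a \<Rightarrow> real"
  where "drift G y \<tau> i a =
    (\<Sum>d\<in>strategies G i. y (i, a, d) * (pure_payoff G \<tau> i d - pure_payoff G \<tau> i a))"

text \<open>
  Under independent play, the gain of player \<open>i\<close> from moving depends on the other players only
  through the expected payoffs of the strategies of \<open>i\<close>. This is what lets one treat the players
  as separate Markov chains.
\<close>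
lemma expected_drift:
  assumes "finite_game G"
  shows "(\<Sum>c\<in>profiles G. product_weight G \<tau> c * (\<Sum>k\<in>deviations G. y k * gain_row G k c))
       = (\<Sum>i\<in>players G. \<Sum>a\<in>strategies G i. pmf (\<tau> i) a * drift G y \<tau> i a)"
proof -
  have fin: "finite (players G)" "\<forall>i\<in>players G. finite (strategies G i)"
    using assms by (auto simp: finite_game_def)
  have "(\<Sum>c\<in>profiles G. product_weight G \<tau> c * (\<Sum>k\<in>deviations G. y k * gain_row G k c))
      = (\<Sum>k\<in>deviations G. y k * (\<Sum>c\<in>profiles G. gain_row G k c * product_weight G \<tau> c))"
    unfolding sum_distrib_left by (subst sum.swap) (simp add: mult_ac)
  also have "\<dots> = (\<Sum>i\<in>players G. \<Sum>a\<in>strategies G i. \<Sum>d\<in>strategies G i.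
       y (i, a, d) * (\<Sum>c\<in>profiles G. gain_row G (i, a, d) c * product_weight G \<tau> c))"
    unfolding deviations_def using fin by (simp add: sum.Sigma sum.cartesian_product)
  also have "\<dots> = (\<Sum>i\<in>players G. \<Sum>a\<in>strategies G i. pmf (\<tau> i) a * drift G y \<tau> i a)"
  proof (intro sum.cong refl)
    fix i a assume ia: "i \<in> players G" "a \<in> strategies G i"
    show "(\<Sum>d\<in>strategies G i.
         y (i, a, d) * (\<Sum>c\<in>profiles G. gain_row G (i, a, d) c * product_weight G \<tau> c))
       = pmf (\<tau> i) a * drift G y \<tau> i a"
      unfolding drift_def sum_distrib_left[of "pmf (\<tau> i) a"]
      by (intro sum.cong) (simp_all only: expected_gain_row[OF assms ia] mult.left_commute)
  qed
  finally show ?thesis .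
qed

lemma correlated_equilibrium_support:
  assumes "finite_game G" "correlated_equilibrium G \<mu>"
  shows "set_pmf \<mu> \<subseteq> (\<Pi>\<^sub>E i\<in>players G. coherent G i)"
proof
  fix c assume c: "c \<in> set_pmf \<mu>"
  then have cp: "c \<in> (\<Pi>\<^sub>E i\<in>players G. strategies G i)"
    using assms by (auto simp: correlated_equilibrium_def profiles_def)
  have "c i \<in> coherent G i" if i: "i \<in> players G" for i
  proof -
    define c' where "c' = restrict c (players G - {i})"
    have c': "c' \<in> profiles_wo G i" using cp unfolding profiles_wo_def c'_def by auto
    then have "pmf \<mu> (c'(i := c i)) \<le> marginal G \<mu> i (c i)"
      unfolding marginal_def
      using finite_profiles_wo[OF assms(1)] c' by (intro member_le_sum) simp_all
    moreover have "c'(i := c i) = c"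
      using cp i unfolding c'_def by (intro ext) (auto simp: restrict_def PiE_def extensional_def)
    ultimately have "0 < marginal G \<mu> i (c i)" using c pmf_positive[of c \<mu>] by simp
    then show ?thesis using assms cp i by (auto simp: coherent_def)
  qed
  then show "c \<in> (\<Pi>\<^sub>E i\<in>players G. coherent G i)" using cp by (auto simp: PiE_iff)
qed

text \<open>
  Strict complementarity, obtained by applying Farkas' lemma once to a sum of objectives. In every
  correlated equilibrium the probability that some player uses a strategy that is not coherent is
  zero, and by pretightness so are the deviation gains between coherent strategies. Hence that
  probability minus all these gains is at most 0, and a dual certificate of this bound becomes the required vector
  when 1 is added to its entries between coherent strategies.
\<close>
lemma pretight_dual_vector:
  assumes G: "finite_game G" and "pretight G"
  shows "\<exists>y. (\<forall>k\<in>deviations G. 0 \<le> y k) \<and>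
    (\<forall>i\<in>players G. \<forall>a\<in>coherent G i. \<forall>d\<in>coherent G i. 0 < y (i, a, d)) \<and>
    (\<forall>c\<in>profiles G. of_bool (c \<notin> (\<Pi>\<^sub>E i\<in>players G. coherent G i))
        \<le> (\<Sum>k\<in>deviations G. y k * gain_row G k c))"
proof -
  define S where "S = (\<Pi>\<^sub>E i\<in>players G. coherent G i)"
  define T where "T = (SIGMA i:players G. coherent G i \<times> coherent G i)"
  have T: "T \<subseteq> deviations G" by (auto simp: T_def deviations_def coherent_def)
  note fin = finite_deviations[OF G] finite_profiles[OF G]
  define b where "b c = of_bool (c \<notin> S) - (\<Sum>k\<in>T. gain_row G k c)" for c
  have "\<exists>y. (\<forall>k\<in>deviations G. 0 \<le> y k) \<and>
      (\<forall>c\<in>profiles G. b c \<le> (\<Sum>k\<in>deviations G. y k * gain_row G k c))"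
  proof (rule farkas_nonneg[OF fin])
    fix v :: "_ \<Rightarrow> real"
    assume v0: "\<And>c. c \<in> profiles G \<Longrightarrow> 0 \<le> v c"
      and v: "\<And>k. k \<in> deviations G \<Longrightarrow> (\<Sum>c\<in>profiles G. gain_row G k c * v c) \<le> 0"
    define s where "s = (\<Sum>c\<in>profiles G. v c)"
    show "(\<Sum>c\<in>profiles G. b c * v c) \<le> 0"
    proof (cases "s = 0")
      case True
      then have "\<forall>c\<in>profiles G. v c = 0"
        using v0 fin by (simp add: s_def sum_nonneg_eq_0_iff)
      then show ?thesis by simp
    next
      case False
      then have s: "0 < s" using v0 unfolding s_def by (metis less_eq_real_def sum_nonneg)
      obtain \<mu> where \<mu>: "set_pmf \<mu> \<subseteq> profiles G" "\<forall>c\<in>profiles G. v c = s * pmf \<mu> c"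
        using pmf_of_weights[of "profiles G" v] fin v0 s unfolding s_def by blast
      have scale: "(\<Sum>c\<in>profiles G. f c * v c) = s * (\<Sum>c\<in>profiles G. f c * pmf \<mu> c)" for f
        unfolding sum_distrib_left by (intro sum.cong) (use \<mu> in auto)
      have gain: "(\<Sum>c\<in>profiles G. gain_row G (i, a, d) c * v c) = s * deviation_gain G \<mu> i a d"
        if "i \<in> players G" "a \<in> strategies G i" for i a d
        unfolding scale deviation_gain_eq[OF G that] ..
      have ce: "correlated_equilibrium G \<mu>"
        unfolding correlated_equilibrium_def
      proof (intro conjI ballI)
        fix i a d assume i: "i \<in> players G" "a \<in> strategies G i" "d \<in> strategies G i"
        have "s * deviation_gain G \<mu> i a d \<le> 0"
          using v[of "(i, a, d)"] i by (simp add: gain deviations_def)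
        then show "deviation_gain G \<mu> i a d \<le> 0" using s by (simp add: mult_le_0_iff)
      qed fact
      have "(\<Sum>c\<in>profiles G. gain_row G k c * v c) = 0" if kT: "k \<in> T" for k
      proof -
        obtain i a d where k: "k = (i, a, d)" "i \<in> players G" "a \<in> coherent G i" "d \<in> coherent G i"
          using kT by (auto simp: T_def)
        then have "deviation_gain G \<mu> i a d = 0" using assms(2) ce by (auto simp: pretight_def)
        then show ?thesis using k gain[of i a d] by (auto simp: coherent_def)
      qed
      moreover have "(\<Sum>c\<in>profiles G. of_bool (c \<notin> S) * v c) = 0"
      proof (intro sum.neutral ballI)
        fix c assume c: "c \<in> profiles G"
        show "of_bool (c \<notin> S) * v c = 0"
          using correlated_equilibrium_support[OF G ce] \<mu>(2) c by (auto simp: S_def set_pmf_iff)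
      qed
      moreover have "(\<Sum>c\<in>profiles G. b c * v c) = (\<Sum>c\<in>profiles G. of_bool (c \<notin> S) * v c)
          - (\<Sum>k\<in>T. \<Sum>c\<in>profiles G. gain_row G k c * v c)"
        unfolding sum.swap[of _ "profiles G" T]
        by (simp add: b_def left_diff_distrib sum_subtractf sum_distrib_right)
      ultimately show ?thesis by simp
    qed
  qed
  then obtain y where y: "\<forall>k\<in>deviations G. 0 \<le> y k"
      "\<forall>c\<in>profiles G. b c \<le> (\<Sum>k\<in>deviations G. y k * gain_row G k c)" by blast
  let ?y = "\<lambda>k. y k + of_bool (k \<in> T)"
  have "of_bool (c \<notin> S) \<le> (\<Sum>k\<in>deviations G. ?y k * gain_row G k c)" if "c \<in> profiles G" for c
  proof -
    have "(\<Sum>k\<in>deviations G. of_bool (k \<in> T) * gain_row G k c) = (\<Sum>k\<in>T. gain_row G k c)"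
      using fin T by (intro sum.mono_neutral_cong_right) auto
    then have "(\<Sum>k\<in>deviations G. ?y k * gain_row G k c)
        = (\<Sum>k\<in>deviations G. y k * gain_row G k c) + (\<Sum>k\<in>T. gain_row G k c)"
      by (simp only: distrib_right sum.distrib)
    then show ?thesis using y(2) that by (fastforce simp: b_def)
  qed
  moreover have "0 < ?y (i, a, d)" if "i \<in> players G" "a \<in> coherent G i" "d \<in> coherent G i" for i a d
  proof -
    have "(i, a, d) \<in> T" using that by (simp add: T_def)
    moreover have "0 \<le> y (i, a, d)" using \<open>(i, a, d) \<in> T\<close> y(1) T by blast
    ultimately show ?thesis by simp
  qed
  ultimately show ?thesis
    using y(1) unfolding S_def by (intro exI[of _ ?y]) auto
qed

section \<open>Pretight games\<close>

theorem proposition6: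
  fixes G :: "('i, 'a) game"
  assumes "finite_game G"
    and "pretight G"
  shows "\<exists>\<sigma>. nash_equilibrium G \<sigma> \<and> quasi_strict G \<sigma> \<and>
           profile_support G \<sigma> = (\<Pi>\<^sub>E i\<in>players G. coherent G i)"
proof -
  note G = assms(1)
  have fin: "finite (players G)" and fin_i: "\<And>i. i \<in> players G \<Longrightarrow> finite (strategies G i)"
    and ne: "\<And>i. i \<in> players G \<Longrightarrow> strategies G i \<noteq> {}"
    using G by (auto simp: finite_game_def)
  define S where "S = (\<Pi>\<^sub>E i\<in>players G. coherent G i)"
  obtain y where y0: "\<forall>k\<in>deviations G. 0 \<le> y k"
    and yS: "\<forall>i\<in>players G. \<forall>a\<in>coherent G i. \<forall>d\<in>coherent G i. 0 < y (i, a, d)"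
    and y: "\<forall>c\<in>profiles G. of_bool (c \<notin> S) \<le> (\<Sum>k\<in>deviations G. y k * gain_row G k c)"
    using pretight_dual_vector[OF assms] unfolding S_def by blast
  have y_nonneg: "0 \<le> y (i, a, d)"
    if "i \<in> players G" "a \<in> strategies G i" "d \<in> strategies G i" for i a d
    using y0 that by (auto simp: deviations_def)
  have "\<exists>p. set_pmf p \<subseteq> strategies G i \<and> stationary (strategies G i) (\<lambda>a d. y (i, a, d)) p"
    if "i \<in> players G" for i
    using stationary_exists[of "strategies G i" "\<lambda>a d. y (i, a, d)"] fin_i ne y_nonneg that by blast
  then obtain \<sigma> where \<sigma>: "\<And>i. i \<in> players G \<Longrightarrow> set_pmf (\<sigma> i) \<subseteq> strategies G i"
    and stat: "\<And>i. i \<in> players G \<Longrightarrow> stationary (strategies G i) (\<lambda>a d. y (i, a, d)) (\<sigma> i)"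
    by metis
  have mixed: "mixed_profile G \<sigma>" using \<sigma> by (auto simp: mixed_profile_def)
  have off_S: "(\<Sum>c\<in>profiles G. product_weight G \<tau> c * of_bool (c \<notin> S))
      \<le> (\<Sum>i\<in>players G. \<Sum>a\<in>strategies G i. pmf (\<tau> i) a * drift G y \<tau> i a)" for \<tau>
    unfolding expected_drift[OF G, symmetric]
    by (intro sum_mono mult_left_mono product_weight_nonneg) (use y in blast)
  have no_drift: "(\<Sum>a\<in>strategies G i. pmf (\<sigma> i) a * drift G y \<tau> i a) = 0"
    if "i \<in> players G" for i \<tau>
    unfolding drift_def by (rule stationary_drift[OF stat[OF that]])

  have supp_sub: "set_pmf (\<sigma> i) \<subseteq> coherent G i" if i: "i \<in> players G" for i
  proof
    fix a assume a: "a \<in> set_pmf (\<sigma> i)"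
    \<comment> \<open>A profile of positive weight in which \<open>i\<close> plays \<open>a\<close>.\<close>
    define c where "c = restrict ((\<lambda>j. SOME b. b \<in> set_pmf (\<sigma> j))(i := a)) (players G)"
    have c: "c j \<in> set_pmf (\<sigma> j)" if "j \<in> players G" for j
      using that a some_in_eq[of "set_pmf (\<sigma> j)"] set_pmf_not_empty by (auto simp: c_def)
    then have cp: "c \<in> profiles G" using \<sigma> unfolding profiles_def
    by (intro PiE_I) (blast, simp add: c_def)
    have pos: "0 < product_weight G \<sigma> c"
      unfolding product_weight_def using c by (intro prod_pos) (auto simp: pmf_positive)
    have "product_weight G \<sigma> c * of_bool (c \<notin> S)
        \<le> (\<Sum>c\<in>profiles G. product_weight G \<sigma> c * of_bool (c \<notin> S))"
      using cp finite_profiles[OF G] product_weight_nonneg by (intro member_le_sum) auto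
    also have "\<dots> \<le> 0" using off_S[of \<sigma>] no_drift by simp
    finally have "c \<in> S" using pos by (cases "c \<in> S") auto
    then show "a \<in> coherent G i" using i by (auto simp: S_def c_def PiE_iff)
  qed
  have supp: "set_pmf (\<sigma> i) = coherent G i" if i: "i \<in> players G" for i
  proof
    obtain a where a: "a \<in> set_pmf (\<sigma> i)" using set_pmf_not_empty[of "\<sigma> i"] by blast
    show "coherent G i \<subseteq> set_pmf (\<sigma> i)"
    proof
      fix d assume d: "d \<in> coherent G i"
      show "d \<in> set_pmf (\<sigma> i)"
      proof (rule stationary_support_closed[OF fin_i[OF i] _ stat[OF i] _ a])
        show "a \<in> strategies G i" using a \<sigma>[OF i] by blast
        show "d \<in> strategies G i" using d by (simp add: coherent_def)
        show "0 < y (i, a, d)" using yS i a d supp_sub[OF i] by blast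
      qed (rule y_nonneg[OF i])
    qed
  qed (rule supp_sub[OF i])

  have drift_ge: "of_bool (a \<notin> coherent G i) \<le> drift G y \<sigma> i a"
    if i: "i \<in> players G" and a: "a \<in> strategies G i" for i a
  proof -
    \<comment> \<open>When \<open>i\<close> alone leaves \<open>\<sigma>\<close>, the other players still have zero expected drift.\<close>
    let ?\<tau> = "\<sigma>(i := return_pmf a)"
    have m: "mixed_profile G ?\<tau>" using mixed a by (auto simp: mixed_profile_def)
    have w0: "product_weight G ?\<tau> c = 0" if "c i \<noteq> a" for c
      unfolding product_weight_def using that i fin by (intro prod_zero) auto
    have "of_bool (a \<notin> coherent G i)
        = (\<Sum>c\<in>profiles G. product_weight G ?\<tau> c * of_bool (a \<notin> coherent G i))"
      using sum_product_weight[OF G m] by (simp flip: sum_distrib_right)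
    also have "\<dots> \<le> (\<Sum>c\<in>profiles G. product_weight G ?\<tau> c * of_bool (c \<notin> S))"
    proof (rule sum_mono)
      fix c
      show "product_weight G ?\<tau> c * of_bool (a \<notin> coherent G i) \<le> product_weight G ?\<tau> c * of_bool (c \<notin> S)"
        using w0[of c] i product_weight_nonneg[of G ?\<tau> c] by (cases "c i = a") (auto simp: S_def PiE_iff)
    qed
    also have "\<dots> \<le> (\<Sum>j\<in>players G. \<Sum>b\<in>strategies G j. pmf (?\<tau> j) b * drift G y ?\<tau> j b)"
      by (rule off_S)
    also have "\<dots> = (\<Sum>b\<in>strategies G i. pmf (?\<tau> i) b * drift G y ?\<tau> i b)"
      using no_drift[where \<tau> = ?\<tau>] by (subst sum.remove[OF fin i]) (simp add: sum.neutral)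
    also have "\<dots> = (\<Sum>b\<in>strategies G i. if b = a then drift G y ?\<tau> i b else 0)"
      by (intro sum.cong) (auto simp: indicator_def)
    also have "\<dots> = drift G y ?\<tau> i a" using a fin_i[OF i] by simp
    also have "\<dots> = drift G y \<sigma> i a" by (simp add: drift_def pure_payoff_def)
    finally show ?thesis .
  qed
  have max_coherent: "a \<in> coherent G i"
    if i: "i \<in> players G" and a: "a \<in> strategies G i"
      and max: "\<forall>d\<in>strategies G i. pure_payoff G \<sigma> i d \<le> pure_payoff G \<sigma> i a" for i a
  proof -
    have "drift G y \<sigma> i a \<le> 0"
      unfolding drift_def using max y_nonneg i a by (intro sum_nonpos mult_nonneg_nonpos) auto
    then show ?thesis using drift_ge[OF i a] by (cases "a \<in> coherent G i") auto
  qed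
  have best: "pure_payoff G \<sigma> i d \<le> pure_payoff G \<sigma> i a"
    if i: "i \<in> players G" and a: "a \<in> coherent G i" and d: "d \<in> strategies G i" for i a d
  proof -
    obtain m where m: "m \<in> strategies G i"
        "\<forall>e\<in>strategies G i. pure_payoff G \<sigma> i e \<le> pure_payoff G \<sigma> i m"
      using finite_has_maximizer[OF fin_i[OF i] ne[OF i]] by blast
    \<comment> \<open>All terms of the drift at \<open>m\<close> are at most 0 and their sum is at least 0, so the one for
        \<open>a\<close>, which has positive rate, vanishes.\<close>
    have mS: "m \<in> coherent G i" using max_coherent[OF i m] .
    have aG: "a \<in> strategies G i" using a by (simp add: coherent_def)
    have "0 \<le> drift G y \<sigma> i m" using drift_ge[OF i m(1)] by (simp add: mS)
    moreover have "drift G y \<sigma> i m \<le> y (i, m, a) * (pure_payoff G \<sigma> i a - pure_payoff G \<sigma> i m)"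
    proof -
      have "(\<Sum>d\<in>strategies G i - {a}. y (i, m, d) * (pure_payoff G \<sigma> i d - pure_payoff G \<sigma> i m)) \<le> 0"
        using m y_nonneg i by (intro sum_nonpos mult_nonneg_nonpos) auto
      then show ?thesis unfolding drift_def by (subst sum.remove[OF fin_i[OF i] aG]) simp
    qed
    moreover have "0 < y (i, m, a)" using yS i mS a by blast
    ultimately have "pure_payoff G \<sigma> i m \<le> pure_payoff G \<sigma> i a"
      by (smt (verit) mult_pos_neg)
    then show ?thesis using m(2) d by fastforce
  qed
  have "nash_equilibrium G \<sigma>"
    unfolding nash_equilibrium_def best_response_def
  proof (intro conjI ballI allI impI)
    fix i \<rho> assume i: "i \<in> players G" and \<rho>: "set_pmf \<rho> \<subseteq> strategies G i"
    obtain m where m: "m \<in> coherent G i" using supp[OF i] set_pmf_not_empty[of "\<sigma> i"] by auto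
    have 1: "(\<Sum>a\<in>strategies G i. pmf p a) = 1" if "set_pmf p \<subseteq> strategies G i" for p
      using that fin_i[OF i] by (rule sum_pmf_eq_1[rotated])
    have "mixed_utility G i (\<sigma>(i := \<rho>)) \<le> (\<Sum>a\<in>strategies G i. pmf \<rho> a * pure_payoff G \<sigma> i m)"
      unfolding mixed_utility_linear[OF G i] using best[OF i m]
      by (intro sum_mono mult_left_mono) auto
    also have "\<dots> = (\<Sum>a\<in>strategies G i. pmf (\<sigma> i) a * pure_payoff G \<sigma> i m)"
      using 1 \<rho> \<sigma>[OF i] by (simp flip: sum_distrib_right)
    also have "\<dots> \<le> mixed_utility G i (\<sigma>(i := \<sigma> i))"
      unfolding mixed_utility_linear[OF G i]
    proof (rule sum_mono)
      fix a
      have "pure_payoff G \<sigma> i m \<le> pure_payoff G \<sigma> i a" if "a \<in> set_pmf (\<sigma> i)"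
        using best[OF i, of a m] that m by (simp add: supp[OF i] coherent_def)
      then show "pmf (\<sigma> i) a * pure_payoff G \<sigma> i m \<le> pmf (\<sigma> i) a * pure_payoff G \<sigma> i a"
        by (cases "a \<in> set_pmf (\<sigma> i)") (auto simp: set_pmf_iff intro: mult_left_mono)
    qed
    finally show "mixed_utility G i (\<sigma>(i := \<rho>)) \<le> mixed_utility G i (\<sigma>(i := \<sigma> i))" .
  qed (use mixed \<sigma> in auto)
  moreover have "quasi_strict G \<sigma>"
    unfolding quasi_strict_def
  proof (intro ballI impI)
    fix i a assume i: "i \<in> players G" and a: "a \<in> strategies G i"
      and "best_response G i \<sigma> (return_pmf a)"
    then have "\<forall>d\<in>strategies G i. pure_payoff G \<sigma> i d \<le> pure_payoff G \<sigma> i a"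
      by (auto simp: best_response_def pure_payoff_def)
    then show "a \<in> set_pmf (\<sigma> i)" using max_coherent[OF i a] supp[OF i] by simp
  qed
  moreover have "profile_support G \<sigma> = (\<Pi>\<^sub>E i\<in>players G. coherent G i)"
    unfolding profile_support_def using supp by (intro PiE_cong) auto
  ultimately show ?thesis by blast
qed

end
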